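(* Let $f=x^{2}+a_{1}x+a_{0}\in\mathbb{R}[x]$ have no real roots, let $\alpha=re^{i\theta}$ (with $r>0$, $0<\theta<\pi$) be the non-real root of $f$ with positive imaginary part, and let $s=\left\lceil \frac{\pi}{\theta}\right\rceil -2$. Put $a_2=1$ and let $$g_{R}=\left\vert \begin{array}{ccccc} a_{2} & & & & x^{0}\\ a_{1} & \ddots & & & \vdots\\ a_{0} & & \ddots & & \vdots\\ & \ddots & & \ddots & \vdots\\ & & a_{0} & a_{1} & x^{s} \end{array} \right\vert ,$$ i.e. $g_R=\det M$ where $M=(M_{k,l})_{0\le k,l\le s}$ is the $(s+1)\times(s+1)$ matrix over $\mathbb{R}[x]$ whose last column is $M_{k,s}=x^{k}$ and whose other columns ($0\le l\le s-1$) are given by $M_{l,l}=a_2=1$, $M_{l+1,l}=a_1$, $M_{l+2,l}=a_0$ (when $l+2\le s$), and all remaining entries $0$. Then $\operatorname{coeffs}(g_R f)\geq 0$.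
   Context: For a polynomial $h\in\mathbb{R}[x]$, $\operatorname{coeffs}(h)\geq 0$ means that all coefficients of $h$ are non-negative. *)

theory Defs
  imports "HOL-Analysis.Complex_Transcendental" "Jordan_Normal_Form.Determinant"
begin

definition coeffs_nonneg :: "real poly \<Rightarrow> bool" where
  "coeffs_nonneg h \<longleftrightarrow> (\<forall>i. 0 \<le> Polynomial.coeff h i)"

text \<open>
  Rows and columns are indexed from 0 to s. The test for the last column comes first, so the
  banded entries only occur in columns l < s; for s = 0 the matrix is (1).
\<close>

definition gR_mat :: "real \<Rightarrow> real \<Rightarrow> real \<Rightarrow> nat \<Rightarrow> real poly mat" where
  "gR_mat a2 a1 a0 s = mat (s + 1) (s + 1) (\<lambda>(k, l).
     if l = s then Polynomial.monom 1 k
     else if k = l then [:a2:]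
     else if k = l + 1 then [:a1:]
     else if k = l + 2 then [:a0:]
     else 0)"

definition gR :: "real \<Rightarrow> real \<Rightarrow> real \<Rightarrow> nat \<Rightarrow> real poly" where
  "gR a2 a1 a0 s = det (gR_mat a2 a1 a0 s)"

end

theory Submission
  imports Defs
begin

text \<open>
  Let \<open>E\<^sub>n\<close> be the coefficients of the power series \<open>1 / (1 + a\<^sub>1 t + a\<^sub>0 t\<^sup>2)\<close>. Multiplying \<open>M\<close> from the left
  by the unitriangular Toeplitz matrix \<open>(E\<^bsub>k-l\<^esub>)\<close> turns the banded columns into unit vectors, so
  \<open>g\<^sub>R = \<Sum>\<^bsub>k\<le>s\<^esub> E\<^bsub>s-k\<^esub> x\<^sup>k\<close>, and the product with \<open>f\<close> telescopes to \<open>x\<^bsup>s+2\<^esup> - E\<^bsub>s+1\<^esub> x + a\<^sub>0 E\<^sub>s\<close>.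
  Since \<open>E\<^sub>n = r\<^sup>n sin ((n+1)\<theta>) / sin \<theta>\<close> and \<open>s + 2\<close> is the least integer that is at least \<open>\<pi> / \<theta>\<close>,
  \<open>E\<^sub>s\<close> is positive and \<open>E\<^bsub>s+1\<^esub>\<close> is not.
\<close>

text \<open>The recurrence comes from comparing coefficients of \<open>t^n\<close> in
  \<open>(1 + a1 t + a0 t^2) * (SUM n. E_n t^n) = 1\<close>.\<close>

fun inv_coeff :: "'a::comm_ring_1 \<Rightarrow> 'a \<Rightarrow> nat \<Rightarrow> 'a" where
  "inv_coeff a1 a0 0 = 1"
| "inv_coeff a1 a0 (Suc 0) = - a1"
| "inv_coeff a1 a0 (Suc (Suc n)) = - a1 * inv_coeff a1 a0 (Suc n) - a0 * inv_coeff a1 a0 n"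

definition inv_toeplitz :: "real \<Rightarrow> real \<Rightarrow> nat \<Rightarrow> real poly mat" where
  "inv_toeplitz a1 a0 s =
     mat (s + 1) (s + 1) (\<lambda>(k, l). if l \<le> k then [:inv_coeff a1 a0 (k - l):] else 0)"

definition inv_poly :: "real \<Rightarrow> real \<Rightarrow> nat \<Rightarrow> real poly" where
  "inv_poly a1 a0 s = (\<Sum>k\<le>s. Polynomial.monom (inv_coeff a1 a0 (s - k)) k)"

lemma inv_poly_Suc:
  "inv_poly a1 a0 (Suc s) = pCons (inv_coeff a1 a0 (Suc s)) (inv_poly a1 a0 s)"
proof -
  have *: "pCons 0 (\<Sum>k\<le>s. F k) = (\<Sum>k\<le>s. pCons 0 (F k))" for F :: "nat \<Rightarrow> real poly"
    by (intro poly_eqI) (simp add: coeff_sum coeff_pCons split: nat.split)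
  have "pCons (inv_coeff a1 a0 (Suc s)) (inv_poly a1 a0 s)
      = [:inv_coeff a1 a0 (Suc s):] + pCons 0 (inv_poly a1 a0 s)" by simp
  then show ?thesis
    unfolding inv_poly_def
    by (simp add: sum.atMost_Suc_shift * monom_Suc monom_0 del: inv_coeff.simps sum.atMost_Suc)
qed

lemma inv_poly_mult:
  "inv_poly a1 a0 s * [:a0, a1, 1:] =
     Polynomial.monom 1 (s + 2) + [:a0 * inv_coeff a1 a0 s, - inv_coeff a1 a0 (Suc s):]"
proof (induction s)
  case 0
  show ?case by (simp add: inv_poly_def monom_0 monom_Suc numeral_2_eq_2)
next
  case (Suc s)
  have "inv_poly a1 a0 (Suc s) * [:a0, a1, 1:]
      = smult (inv_coeff a1 a0 (Suc s)) [:a0, a1, 1:] + pCons 0 (inv_poly a1 a0 s * [:a0, a1, 1:])"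
    by (simp add: inv_poly_Suc del: inv_coeff.simps)
  also have "\<dots> = Polynomial.monom 1 (Suc s + 2)
      + [:a0 * inv_coeff a1 a0 (Suc s), - inv_coeff a1 a0 (Suc (Suc s)):]"
    \<comment> \<open>The \<open>x^2\<close> terms cancel, and the coefficient of \<open>x\<close>,
      \<open>a1 E_(s+1) + a0 E_s\<close>, is \<open>- E_(s+2)\<close> by the recurrence.\<close>
    unfolding Suc.IH by (simp add: monom_Suc algebra_simps)
  finally show ?case .
qed

text \<open>For \<open>l < s\<close> the entry is \<open>E_n + a1 E_(n-1) + a0 E_(n-2)\<close> at
  \<open>n = k - l\<close>, with \<open>E\<close> zero at negative indices: the coefficient of
  \<open>t^n\<close> in the constant series 1.\<close>

lemma inv_toeplitz_mult_gR_mat: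
  assumes "k \<le> s" "l \<le> s"
  shows "(inv_toeplitz a1 a0 s * gR_mat 1 a1 a0 s) $$ (k, l) =
    (if l < s then if k = l then 1 else 0
     else inv_poly a1 a0 k)"
proof -
  define A :: "nat \<Rightarrow> real poly" where
    "A i = (if i \<le> k then [:inv_coeff a1 a0 (k - i):] else 0)" for i
  have entry: "(inv_toeplitz a1 a0 s * gR_mat 1 a1 a0 s) $$ (k, l)
      = (\<Sum>i\<le>s. A i * gR_mat 1 a1 a0 s $$ (i, l))"
    using assms
    by (auto simp: inv_toeplitz_def gR_mat_def scalar_prod_def A_def atLeast0LessThan lessThan_Suc_atMost
             intro!: sum.cong)
  show ?thesis
  proof (cases "l < s")
    case True
    have "(\<Sum>i\<le>s. A i * gR_mat 1 a1 a0 s $$ (i, l))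
        = (\<Sum>i\<le>s. (if i = l then A i else 0) + (if i = l + 1 then A i * [:a1:] else 0)
                  + (if i = l + 2 then A i * [:a0:] else 0))"
      using True by (intro sum.cong) (auto simp: gR_mat_def one_pCons)
    also have "\<dots> = A l + A (l + 1) * [:a1:] + (if l + 2 \<le> s then A (l + 2) * [:a0:] else 0)"
      using True by (simp add: sum.distrib)
    \<comment> \<open>If \<open>l + 2 > s\<close>, then \<open>l + 2 > k\<close>, so
      \<open>A (l + 2)\<close> is zero anyway.\<close>
    also have "\<dots> = A l + A (l + 1) * [:a1:] + A (l + 2) * [:a0:]"
      using assms by (simp add: A_def)
    also have "\<dots> = (if k = l then 1 else 0)"
    proof -
      \<comment> \<open>These cases decide how many of the three terms survive: none, one, two, or
        all three; only the last needs the recurrence step.\<close>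
      consider "k < l" | "k = l" | "k = l + 1" | n where "k = l + 2 + n"
        using le_Suc_ex[of "l + 2" k] by fastforce
      then show ?thesis
        by cases (simp_all add: A_def one_pCons Suc_diff_le)
    qed
    finally show ?thesis using entry True by simp
  next
    case False
    with assms have "l = s" by simp
    then have "(\<Sum>i\<le>s. A i * gR_mat 1 a1 a0 s $$ (i, l)) = (\<Sum>i\<le>s. A i * Polynomial.monom 1 i)"
      by (intro sum.cong) (auto simp: gR_mat_def)
    also have "\<dots> = (\<Sum>i\<le>k. A i * Polynomial.monom 1 i)"
      using assms by (intro sum.mono_neutral_right) (auto simp: A_def)
    also have "\<dots> = inv_poly a1 a0 k"
      unfolding inv_poly_def by (intro sum.cong) (auto simp: A_def smult_monom)
    finally show ?thesis using entry False by simp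
  qed
qed

text \<open>The Toeplitz factor has determinant 1, and the product is upper triangular with every
  diagonal entry before the last equal to 1.\<close>

lemma gR_eq_inv_poly: "gR 1 a1 a0 s = inv_poly a1 a0 s"
proof -
  let ?T = "inv_toeplitz a1 a0 s" and ?M = "gR_mat 1 a1 a0 s"
  have T: "?T \<in> carrier_mat (s + 1) (s + 1)" and M: "?M \<in> carrier_mat (s + 1) (s + 1)"
    by (simp_all add: inv_toeplitz_def gR_mat_def)
  have TM: "?T * ?M \<in> carrier_mat (s + 1) (s + 1)" using T M by simp
  have "det ?T = prod_list (diag_mat ?T)"
    by (rule det_lower_triangular[OF _ T]) (simp add: inv_toeplitz_def)
  also have "\<dots> = (\<Prod>i = 0..<s + 1. ?T $$ (i, i))"
    using T by (simp only: prod_list_diag_prod carrier_matD)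
  also have "\<dots> = 1"
    by (rule prod.neutral) (auto simp: inv_toeplitz_def one_pCons)
  finally have detT: "det ?T = 1" .
  have "upper_triangular (?T * ?M)"
    using T M by (auto simp: inv_toeplitz_mult_gR_mat simp del: index_mult_mat(1))
  then have "det (?T * ?M) = prod_list (diag_mat (?T * ?M))"
    using TM by (rule det_upper_triangular)
  also have "\<dots> = (\<Prod>i = 0..<s + 1. (?T * ?M) $$ (i, i))"
    using TM by (simp only: prod_list_diag_prod carrier_matD)
  also have "\<dots> = inv_poly a1 a0 s"
    by (simp add: inv_toeplitz_mult_gR_mat del: index_mult_mat(1))
  finally show ?thesis
    using det_mult[OF T M] detT by (simp add: gR_def)
qed

text \<open>In Chebyshev terms, \<open>E_n = r^n U_n(cos \<theta>)\<close>. Keeping the factor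
  \<open>sin \<theta>\<close> on the left avoids a division.\<close>

lemma inv_coeff_sin:
  "inv_coeff (- 2 * r * cos \<theta>) (r\<^sup>2) n * sin \<theta> = r ^ n * sin (real (n + 1) * \<theta>)"
proof (induction n rule: induct_nat_012)
  case 0
  show ?case by simp
next
  case 1
  show ?case by (simp add: sin_double)
next
  case (ge2 n)
  have "sin (real (n + 3) * \<theta>) + sin (real (n + 1) * \<theta>) = 2 * cos \<theta> * sin (real (n + 2) * \<theta>)"
    using sin_add[of "real (n + 2) * \<theta>" \<theta>] sin_diff[of "real (n + 2) * \<theta>" \<theta>]
    by (simp add: algebra_simps)
  \<comment> \<open>With the sines replaced by arbitrary reals, only ring arithmetic
    remains.\<close>
  moreover have "r ^ (n + 2) * x = 2 * r * c * (r ^ (n + 1) * y) - r\<^sup>2 * (r ^ n * z)"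
    if "x + z = 2 * c * y" for c x y z :: real
  proof -
    from that have x: "x = 2 * c * y - z" by simp
    show ?thesis unfolding x by (simp add: power2_eq_square algebra_simps)
  qed
  ultimately have "r ^ (n + 2) * sin (real (n + 3) * \<theta>)
      = 2 * r * cos \<theta> * (r ^ (n + 1) * sin (real (n + 2) * \<theta>)) - r\<^sup>2 * (r ^ n * sin (real (n + 1) * \<theta>))"
    by blast
  moreover have "inv_coeff (- 2 * r * cos \<theta>) (r\<^sup>2) (Suc (Suc n)) * sin \<theta>
      = 2 * r * cos \<theta> * (inv_coeff (- 2 * r * cos \<theta>) (r\<^sup>2) (Suc n) * sin \<theta>)
        - r\<^sup>2 * (inv_coeff (- 2 * r * cos \<theta>) (r\<^sup>2) n * sin \<theta>)"
    unfolding inv_coeff.simps(3) left_diff_distrib by (simp only: mult.assoc minus_mult_left minus_minus)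
  ultimately show ?case
    unfolding ge2.IH by (simp add: eval_nat_numeral del: of_nat_Suc)
qed

text \<open>The imaginary part of the root equation determines \<open>a1\<close>; the real part then
  gives \<open>a0\<close>.\<close>

lemma polar_root_coeffs:
  assumes "poly (map_poly complex_of_real [:a0, a1, 1:])
             (complex_of_real r * exp (\<i> * complex_of_real \<theta>)) = 0"
    and "r > 0" "sin \<theta> \<noteq> 0"
  shows "a1 = - 2 * r * cos \<theta>" "a0 = r\<^sup>2"
proof -
  have ex: "complex_of_real r * exp (\<i> * complex_of_real \<theta>) = Complex (r * cos \<theta>) (r * sin \<theta>)"
    by (simp add: complex_eq_iff Re_exp Im_exp)
  have "Complex a0 0 + Complex (r * cos \<theta>) (r * sin \<theta>) *
      (Complex a1 0 + Complex (r * cos \<theta>) (r * sin \<theta>)) = 0"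
    using assms(1) unfolding ex by (simp add: map_poly_pCons complex_eq_iff)
  then have re: "a0 + r * cos \<theta> * (a1 + r * cos \<theta>) - r * sin \<theta> * (r * sin \<theta>) = 0"
    and im: "r * sin \<theta> * (a1 + 2 * r * cos \<theta>) = 0"
    by (simp_all add: complex_eq_iff algebra_simps)
  from im assms(2,3) show a1: "a1 = - 2 * r * cos \<theta>" by simp
  \<comment> \<open>Here \<open>u\<close> and \<open>v\<close> stand for \<open>sin \<theta>\<close>
    and \<open>cos \<theta>\<close>.\<close>
  have "x = r\<^sup>2 * (u\<^sup>2 + v\<^sup>2)"
    if "x + r * v * (- 2 * r * v + r * v) - r * u * (r * u) = 0" for u v x :: real
    using that by (simp add: power2_eq_square algebra_simps)
  from this[OF re[unfolded a1]] have "a0 = r\<^sup>2 * ((sin \<theta>)\<^sup>2 + (cos \<theta>)\<^sup>2)" .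
  then show "a0 = r\<^sup>2" by simp
qed

theorem theorem2:
  fixes a0 a1 a2 r \<theta> :: real and f :: "real poly" and \<alpha> :: complex and s :: nat
  assumes "f = [:a0, a1, a2:]" and "a2 = 1"
    and "\<forall>x::real. poly f x \<noteq> 0"
    and "r > 0" and "0 < \<theta>" and "\<theta> < pi"
    and "\<alpha> = complex_of_real r * exp (\<i> * complex_of_real \<theta>)"
    and "poly (map_poly complex_of_real f) \<alpha> = 0" and "Im \<alpha> > 0"
    and "int s = \<lceil>pi / \<theta>\<rceil> - 2"
  shows "coeffs_nonneg (gR a2 a1 a0 s * f)"
proof -
  have sin: "sin \<theta> > 0" using assms(5,6) by (rule sin_gt_zero)
  have a: "a1 = - 2 * r * cos \<theta>" "a0 = r\<^sup>2"
    using polar_root_coeffs[of a0 a1 r \<theta>] assms(1,2,4,7,8) sin by auto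
  have "\<lceil>pi / \<theta>\<rceil> = int s + 2" using assms(10) by simp
  then have "real s + 1 < pi / \<theta>" and "pi / \<theta> \<le> real s + 2"
    by (simp_all add: ceiling_eq_iff)
  then have lt: "real (s + 1) * \<theta> < pi" and le: "pi \<le> real (s + 2) * \<theta>"
    using assms(5) by (simp_all add: field_simps)
  have "sin (real (s + 1) * \<theta>) > 0"
    using lt assms(5) by (intro sin_gt_zero) auto
  then have "inv_coeff a1 a0 s * sin \<theta> \<ge> 0"
    unfolding a inv_coeff_sin using assms(4) by simp
  then have pos: "inv_coeff a1 a0 s \<ge> 0"
    using sin by (simp add: zero_le_mult_iff)
  \<comment> \<open>From \<open>(s + 1) \<theta> < pi\<close> the shifted angle is below
    \<open>\<theta>\<close>, hence in the interval from 0 to \<open>pi\<close>. It is 0 exactly when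
    \<open>pi / \<theta>\<close> is an integer.\<close>
  have "sin (real (s + 2) * \<theta> - pi) \<ge> 0"
    using lt le assms(6) by (intro sin_ge_zero) (auto simp: algebra_simps)
  then have "sin (real (Suc s + 1) * \<theta>) \<le> 0" by (simp add: sin_diff)
  then have "inv_coeff a1 a0 (Suc s) * sin \<theta> \<le> 0"
    unfolding a inv_coeff_sin using assms(4) by (simp add: mult_nonneg_nonpos)
  then have neg: "inv_coeff a1 a0 (Suc s) \<le> 0"
    using sin by (simp add: mult_le_0_iff)
  have "gR a2 a1 a0 s * f =
      Polynomial.monom 1 (s + 2) + [:a0 * inv_coeff a1 a0 s, - inv_coeff a1 a0 (Suc s):]"
    using assms(1,2) by (simp only: gR_eq_inv_poly inv_poly_mult)
  moreover have "a0 \<ge> 0" using a by simp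
  ultimately show ?thesis
    using pos neg
    by (auto simp: coeffs_nonneg_def coeff_pCons split: nat.split simp del: inv_coeff.simps)
qed

end
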